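(* Let $I$ be a past interval, $E$ a Banach space, $H\subset\mathrm{Map}(I,E)$ a history space, $F\colon\mathbb{R}\times H\supset\mathrm{dom}(F)\to E$ a map, and $(t_0,\phi_0)\in\mathrm{dom}(F)$. Suppose that (i) $H$ is $C^1$-prolongable and regulated by $C^1$-prolongations, (ii) $F$ is continuous, and (iii) $\mathrm{dom}(F)$ is a neighborhood by $C^1$-prolongations of $(t_0,\phi_0)$. If $F$ is locally Lipschitzian about $C^1$-prolongations at $(t_0,\phi_0)$, then there exists $T>0$ such that the initial value problem $$\dot x(t)=F(t,I_tx)\quad(t\ge t_0),\qquad I_{t_0}x=\phi_0$$ has a unique $C^1$-solution $x\colon[t_0,t_0+T]+I\to E$.
   Context: Basic notation. $E=(E,\|\cdot\|_E)$ is a Banach space, $\mathbb{R}_+=[0,\infty)$, $\mathbb{R}_-=(-\infty,0]$. A past interval is an interval $I\subset\mathbb{R}_-$ with $0\in I$. $\mathrm{Map}(I,E)$ is the linear space of all maps $I\to E$; $\boldsymbol 0$ is the zero map. For an interval $J$, $J+I=\{t+\theta:t\in J,\theta\in I\}$. If $\gamma$ is an $E$-valued map defined on $J+I$ and $t\in J$, then $I_t\gamma\in\mathrm{Map}(I,E)$ is $I_t\gamma(\theta)=\gamma(t+\theta)$. A history space is a linear subspace $H\subset\mathrm{Map}(I,E)$ with a topology for which the linear operations are continuous. Prolongations. For $(\sigma,\psi)\in\mathbb{R}\times\mathrm{Map}(I,E)$, a $C^1$-prolongation of $(\sigma,\psi)$ is a map $\gamma\colon J+I\to E$, where $J$ is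 an interval with left end point $\sigma\in J$ ($J=\{\sigma\}$ allowed, any such map then counting as $C^1$), with $I_\sigma\gamma=\psi$ and $\gamma|_J$ of class $C^1$ (one-sided derivatives at end points). A $C^1$-prolongation of $\psi$ is one of $(0,\psi)$. For $v\in E$, $\psi^{\wedge v}\colon\mathbb{R}_++I\to E$ is $\psi^{\wedge v}(t)=\psi(t)$ for $t\in I$ and $\psi^{\wedge v}(t)=\psi(0)+tv$ for $t\ge0$. For an interval $[0,T]$, $\|g\|_{C^1[0,T]}=\sup_{[0,T]}\|g\|_E+\sup_{[0,T]}\|g'\|_E$. For $T>0$, $0\le\delta\le\infty$, $v\in E$, $\varGamma^1_{\sigma,\psi}(T,\delta,v)$ is the set of $C^1$-prolongations $\gamma\colon[\sigma,\sigma+T]+I\to E$ of $(\sigma,\psi)$ with $\|\gamma(\sigma+\cdot)-\psi^{\wedge v}(\cdot)\|_{C^1[0,T]}\le\delta$ and $\gamma'(\sigma)=v$ (right derivative); $\varGamma^1_{\sigma,\psi}(0,\delta,v)=\{\psi(\cdot-\sigma)\colon\sigma+I\to E\}$. The rectangle by $C^1$-prolongations is $$\varLambda^1_{\sigma,\psi}(T,\delta,v)=\bigcup_{\tau\in[0,T]}\{(\sigma+\tau,I_{\sigma+\tau}\gamma):\gamma\in\varGamma^1_{\sigma,\psi}(\tau,\delta,v)\}.$$ For $(\sigma,\psi)\in\mathrm{dom}(F)$, $\varLambda^1_{\sigma,\psi}(T,\delta;F):=\varLambda^1_{\sigma,\psi}(T,\delta,F(\sigma,\psi))$. Properties of $H$.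 $H$ is closed under $C^1$-prolongations if $I_t\gamma\in H$ for all $t\ge0$, for every $\psi\in H$ and every $C^1$-prolongation $\gamma\colon\mathbb{R}_++I\to E$ of $\psi$. $H$ is $C^1$-prolongable if moreover $t\mapsto I_t\gamma\in H$ is continuous on $\mathbb{R}_+$ for all such $\gamma$. $H$ is regulated by $C^1$-prolongations if for every $T>0$ and every neighborhood $N$ of $\boldsymbol 0$ in $H$ there is $\delta>0$ with $\varLambda^1_{0,\boldsymbol 0}(T,\delta,0)\subset[0,T]\times N$. A subset $W\subset\mathbb{R}\times H$ is a neighborhood by $C^1$-prolongations of $(\sigma_0,\psi_0)$ if for every $v\in E$ there are $T,\delta>0$ with $\varLambda^1_{\sigma_0,\psi_0}(T,\delta,v)\subset W$. Lipschitz condition. For $L>0$ and $(t,\phi_1),(t,\phi_2)\in\mathrm{dom}(F)$ with $\mathrm{supp}(\phi_1-\phi_2)$ compact, $L$-(Lip) is the inequality $\|F(t,\phi_1)-F(t,\phi_2)\|_E\le L\|\phi_1-\phi_2\|_\infty$ (sup norm over $I$). $F$ is locally Lipschitzian about $C^1$-prolongations at $(\sigma_0,\psi_0)\in\mathrm{dom}(F)$ if there are $T,\delta,L>0$ such that $L$-(Lip) holds for all $(t,\phi_1),(t,\phi_2)\in\varLambda^1_{\sigma_0,\psi_0}(T,\delta;F)\cap\mathrm{dom}(F)$. Solutions. A solution of the initial value problem is a map $x\colon J+I\to E$, $J$ a non-degenerate interval with left end point $t_0\in J$, such that $I_{t_0}x=\phi_0$, $(t,I_tx)\in\mathrm{dom}(F)$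 for all $t\in J$, and $x|_J$ is differentiable with $(x|_J)'(t)=F(t,I_tx)$ for all $t\in J$. It is a $C^1$-solution if $x|_J$ is of class $C^1$. *)

theory Defs
  imports "HOL-Analysis.Analysis" "HOL-Library.Set_Algebras"
begin

section \<open>Maps on subsets of the real line\<close>

text \<open>
  A map from a set \<open>A\<close> of reals to \<open>E\<close> is encoded by its unique extension to a total function
  that vanishes off \<open>A\<close>.  Equality of functions is then equality of maps on \<open>A\<close>, and the
  linear operations are the pointwise ones.  The set \<open>J + I\<close> is the Minkowski sum.
\<close>

definition maps_on :: "real set \<Rightarrow> (real \<Rightarrow> 'e::real_vector) set" where
  "maps_on A = {f. \<forall>t. t \<notin> A \<longrightarrow> f t = 0}"

definition past_interval :: "real set \<Rightarrow> bool" where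
  "past_interval I \<longleftrightarrow> is_interval I \<and> I \<subseteq> {..0} \<and> 0 \<in> I"

definition interval_from :: "real \<Rightarrow> real set \<Rightarrow> bool" where
  "interval_from \<sigma> J \<longleftrightarrow> is_interval J \<and> \<sigma> \<in> J \<and> J \<subseteq> {\<sigma>..}"

definition history :: "real set \<Rightarrow> real \<Rightarrow> (real \<Rightarrow> 'e::real_vector) \<Rightarrow> real \<Rightarrow> 'e" where
  "history I t \<gamma> = (\<lambda>\<theta>. if \<theta> \<in> I then \<gamma> (t + \<theta>) else 0)"

text \<open>
  A history space \<open>H\<close> is given by an abstract topology \<open>X\<close> with \<open>topspace X = H\<close>.  No separation
  axiom is imposed.
\<close>

definition history_space :: "real set \<Rightarrow> (real \<Rightarrow> 'e::banach) topology \<Rightarrow> bool" where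
  "history_space I X \<longleftrightarrow>
     topspace X \<subseteq> maps_on I \<and>
     (\<lambda>\<theta>. 0) \<in> topspace X \<and>
     (\<forall>\<phi>\<in>topspace X. \<forall>\<psi>\<in>topspace X. (\<lambda>\<theta>. \<phi> \<theta> + \<psi> \<theta>) \<in> topspace X) \<and>
     (\<forall>c. \<forall>\<phi>\<in>topspace X. (\<lambda>\<theta>. c *\<^sub>R \<phi> \<theta>) \<in> topspace X) \<and>
     continuous_map (prod_topology X X) X (\<lambda>(\<phi>, \<psi>). \<lambda>\<theta>. \<phi> \<theta> + \<psi> \<theta>) \<and>
     continuous_map (prod_topology euclideanreal X) X (\<lambda>(c, \<phi>). \<lambda>\<theta>. c *\<^sub>R \<phi> \<theta>)"


section \<open>Prolongations\<close>

text \<open>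
  Derivatives are taken within \<open>J\<close>, hence are one-sided at the end points of \<open>J\<close>.  If \<open>J\<close> is a
  singleton the filter \<open>at t within J\<close> is trivial and the condition holds for every \<open>f\<close>.
\<close>

definition C1_on :: "real set \<Rightarrow> (real \<Rightarrow> 'e::real_normed_vector) \<Rightarrow> bool" where
  "C1_on J f \<longleftrightarrow>
     (\<exists>f'. continuous_on J f' \<and> (\<forall>t\<in>J. (f has_vector_derivative f' t) (at t within J)))"

definition C1_prolongation ::
  "real set \<Rightarrow> real \<Rightarrow> (real \<Rightarrow> 'e::banach) \<Rightarrow> real set \<Rightarrow> (real \<Rightarrow> 'e) \<Rightarrow> bool" where
  "C1_prolongation I \<sigma> \<psi> J \<gamma> \<longleftrightarrow>
     interval_from \<sigma> J \<and> \<gamma> \<in> maps_on (J + I) \<and> history I \<sigma> \<gamma> = \<psi> \<and> C1_on J \<gamma>"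

definition linear_prolongation :: "(real \<Rightarrow> 'e::real_vector) \<Rightarrow> 'e \<Rightarrow> real \<Rightarrow> 'e" where
  "linear_prolongation \<psi> v t = (if 0 \<le> t then \<psi> 0 + t *\<^sub>R v else \<psi> t)"

definition C1_norm :: "real \<Rightarrow> (real \<Rightarrow> 'e::real_normed_vector) \<Rightarrow> ennreal" where
  "C1_norm T g =
     (SUP t\<in>{0..T}. ennreal (norm (g t))) +
     (SUP t\<in>{0..T}. ennreal (norm (vector_derivative g (at t within {0..T}))))"

text \<open>The type \<^typ>\<open>ennreal\<close> accounts for radii \<open>\<delta>\<close> in the range from 0 to infinity, both included.\<close>

definition Gamma1 ::
  "real set \<Rightarrow> real \<Rightarrow> (real \<Rightarrow> 'e::banach) \<Rightarrow> real \<Rightarrow> ennreal \<Rightarrow> 'e \<Rightarrow> (real \<Rightarrow> 'e) set" where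
  "Gamma1 I \<sigma> \<psi> T \<delta> v =
     (if T = 0 then {\<lambda>t. \<psi> (t - \<sigma>)}
      else {\<gamma>. C1_prolongation I \<sigma> \<psi> {\<sigma>..\<sigma> + T} \<gamma> \<and>
               C1_norm T (\<lambda>t. \<gamma> (\<sigma> + t) - linear_prolongation \<psi> v t) \<le> \<delta> \<and>
               (\<gamma> has_vector_derivative v) (at_right \<sigma>)})"

definition Lambda1 ::
  "real set \<Rightarrow> real \<Rightarrow> (real \<Rightarrow> 'e::banach) \<Rightarrow> real \<Rightarrow> ennreal \<Rightarrow> 'e \<Rightarrow> (real \<times> (real \<Rightarrow> 'e)) set" where
  "Lambda1 I \<sigma> \<psi> T \<delta> v =
     (\<Union>\<tau>\<in>{0..T}. {(\<sigma> + \<tau>, history I (\<sigma> + \<tau>) \<gamma>) | \<gamma>. \<gamma> \<in> Gamma1 I \<sigma> \<psi> \<tau> \<delta> v})"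


section \<open>Properties of the history space\<close>

definition closed_under_C1_prolongations ::
  "real set \<Rightarrow> (real \<Rightarrow> 'e::banach) set \<Rightarrow> bool" where
  "closed_under_C1_prolongations I H \<longleftrightarrow>
     (\<forall>\<psi>\<in>H. \<forall>\<gamma>. C1_prolongation I 0 \<psi> {0..} \<gamma> \<longrightarrow> (\<forall>t\<ge>0. history I t \<gamma> \<in> H))"

definition C1_prolongable :: "real set \<Rightarrow> (real \<Rightarrow> 'e::banach) topology \<Rightarrow> bool" where
  "C1_prolongable I X \<longleftrightarrow>
     closed_under_C1_prolongations I (topspace X) \<and>
     (\<forall>\<psi>\<in>topspace X. \<forall>\<gamma>. C1_prolongation I 0 \<psi> {0..} \<gamma> \<longrightarrow>
        continuous_map (top_of_set {0..}) X (\<lambda>t. history I t \<gamma>))"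

definition regulated_by_C1_prolongations ::
  "real set \<Rightarrow> (real \<Rightarrow> 'e::banach) topology \<Rightarrow> bool" where
  "regulated_by_C1_prolongations I X \<longleftrightarrow>
     (\<forall>T>0. \<forall>N. N \<subseteq> topspace X \<and> (\<exists>U. openin X U \<and> (\<lambda>\<theta>. 0) \<in> U \<and> U \<subseteq> N) \<longrightarrow>
        (\<exists>\<delta>>0. Lambda1 I 0 (\<lambda>\<theta>. 0) T \<delta> 0 \<subseteq> {0..T} \<times> N))"

definition neighborhood_by_C1_prolongations ::
  "real set \<Rightarrow> (real \<times> (real \<Rightarrow> 'e::banach)) set \<Rightarrow> real \<Rightarrow> (real \<Rightarrow> 'e) \<Rightarrow> bool" where
  "neighborhood_by_C1_prolongations I W \<sigma> \<psi> \<longleftrightarrow>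
     (\<forall>v. \<exists>T>0. \<exists>\<delta>>0. Lambda1 I \<sigma> \<psi> T \<delta> v \<subseteq> W)"


section \<open>The Lipschitz condition\<close>

text \<open>
  A partial map \<open>F\<close> is given by a total function together with its domain \<open>D\<close>.  The support of a
  map on \<open>I\<close> is the closure relative to \<open>I\<close> of the set where it is nonzero.
\<close>

definition supp_on :: "real set \<Rightarrow> (real \<Rightarrow> 'e::real_vector) \<Rightarrow> real set" where
  "supp_on I \<phi> = I \<inter> closure {\<theta>\<in>I. \<phi> \<theta> \<noteq> 0}"

definition sup_norm_on :: "real set \<Rightarrow> (real \<Rightarrow> 'e::real_normed_vector) \<Rightarrow> ennreal" where
  "sup_norm_on I \<phi> = (SUP \<theta>\<in>I. ennreal (norm (\<phi> \<theta>)))"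

definition locally_Lipschitz_about_C1_prolongations ::
  "real set \<Rightarrow> (real \<times> (real \<Rightarrow> 'e::banach)) set \<Rightarrow> (real \<times> (real \<Rightarrow> 'e) \<Rightarrow> 'e) \<Rightarrow>
    real \<Rightarrow> (real \<Rightarrow> 'e) \<Rightarrow> bool" where
  "locally_Lipschitz_about_C1_prolongations I D F \<sigma> \<psi> \<longleftrightarrow>
     (\<exists>T>0. \<exists>\<delta>>0. \<exists>L>0. \<forall>t \<phi>\<^sub>1 \<phi>\<^sub>2.
        (t, \<phi>\<^sub>1) \<in> Lambda1 I \<sigma> \<psi> T \<delta> (F (\<sigma>, \<psi>)) \<inter> D \<and>
        (t, \<phi>\<^sub>2) \<in> Lambda1 I \<sigma> \<psi> T \<delta> (F (\<sigma>, \<psi>)) \<inter> D \<and>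
        compact (supp_on I (\<lambda>\<theta>. \<phi>\<^sub>1 \<theta> - \<phi>\<^sub>2 \<theta>)) \<longrightarrow>
        ennreal (norm (F (t, \<phi>\<^sub>1) - F (t, \<phi>\<^sub>2)))
          \<le> ennreal L * sup_norm_on I (\<lambda>\<theta>. \<phi>\<^sub>1 \<theta> - \<phi>\<^sub>2 \<theta>))"


section \<open>Solutions\<close>

definition ivp_solution ::
  "real set \<Rightarrow> (real \<times> (real \<Rightarrow> 'e::banach)) set \<Rightarrow> (real \<times> (real \<Rightarrow> 'e) \<Rightarrow> 'e) \<Rightarrow>
    real \<Rightarrow> (real \<Rightarrow> 'e) \<Rightarrow> real set \<Rightarrow> (real \<Rightarrow> 'e) \<Rightarrow> bool" where
  "ivp_solution I D F t\<^sub>0 \<phi>\<^sub>0 J x \<longleftrightarrow>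
     interval_from t\<^sub>0 J \<and> J \<noteq> {t\<^sub>0} \<and> x \<in> maps_on (J + I) \<and>
     history I t\<^sub>0 x = \<phi>\<^sub>0 \<and>
     (\<forall>t\<in>J. (t, history I t x) \<in> D \<and>
            (x has_vector_derivative F (t, history I t x)) (at t within J))"

definition C1_solution ::
  "real set \<Rightarrow> (real \<times> (real \<Rightarrow> 'e::banach)) set \<Rightarrow> (real \<times> (real \<Rightarrow> 'e) \<Rightarrow> 'e) \<Rightarrow>
    real \<Rightarrow> (real \<Rightarrow> 'e) \<Rightarrow> real set \<Rightarrow> (real \<Rightarrow> 'e) \<Rightarrow> bool" where
  "C1_solution I D F t\<^sub>0 \<phi>\<^sub>0 J x \<longleftrightarrow> ivp_solution I D F t\<^sub>0 \<phi>\<^sub>0 J x \<and> C1_on J x"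

end

theory Submission
  imports Defs
begin

text \<open>
  A solution is determined by its velocity.  In shifted time, a \<open>C\<^sup>1\<close>-prolongation of \<open>\<phi>\<^sub>0\<close> with velocity
  \<open>u\<close> is \<open>\<phi>\<^sub>0\<close> followed by \<open>t \<mapsto> \<phi>\<^sub>0 0 + \<integral>\<^sub>0\<^sup>t u\<close>, so the initial value problem on \<open>[t\<^sub>0, t\<^sub>0 + T]\<close> is
  the fixed point equation \<open>u s = F (t\<^sub>0 + s, history of the prolongation by u at s)\<close> for continuous
  \<open>u\<close> on \<open>[0, T]\<close>.  Taking the velocity as the unknown makes the smallness that defines the
  rectangles a plain supremum bound: if \<open>u 0 = v\<close> and \<open>\<parallel>u - v\<parallel> \<le> \<eta>\<close> on \<open>[0, s]\<close>, then the prolongation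
  differs from the linear one by at most \<open>s * \<eta>\<close> in value and \<open>\<eta>\<close> in derivative, hence its history
  lies in the rectangle of radius \<open>(1 + s) * \<eta>\<close>; this is \<open>history_prolong_in_Lambda1\<close>.  The
  histories of two such prolongations differ, in the supremum norm, by at most \<open>s\<close> times the
  distance of the velocities.

  Let \<open>v = F (t\<^sub>0, \<phi>\<^sub>0)\<close> and fix \<open>\<eta>\<close> so that the relevant rectangles lie in the domain and the
  Lipschitz condition holds on them.  The right-hand side of the equation then has Lipschitz constant
  \<open>L * T\<close> in \<open>u\<close>.  Along the linear prolongation it is a continuous function of \<open>s\<close> alone with value
  \<open>v\<close> at \<open>0\<close>, so for small \<open>T\<close> it stays within \<open>\<eta> / 2\<close> of \<open>v\<close>.  With \<open>L * T \<le> 1 / 4\<close> the map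
  preserves the ball of radius \<open>\<eta>\<close> about \<open>v\<close> and contracts it; Banach's theorem gives exactly one
  fixed point in the ball (\<open>feedback_fixed_point\<close>).

  Uniqueness among all \<open>C\<^sup>1\<close>-solutions, including those not assumed close to the linear prolongation,
  comes from the strictness in the previous estimate: it bounds \<open>\<parallel>u s - v\<parallel>\<close> by \<open>3 / 4 * \<eta>\<close> as soon
  as \<open>\<parallel>u - v\<parallel> \<le> \<eta>\<close> on \<open>[0, s]\<close>, so the velocity of a solution cannot reach distance \<open>\<eta>\<close> for a
  first time (\<open>solution_velocity_near_initial_velocity\<close>).  It is therefore a fixed point in
  the ball.
\<close>

section \<open>Sums of an interval and a past interval\<close>

text \<open>
  A point \<open>j + \<theta>\<close> of the sum lies in \<open>J\<close> if it is right of \<open>a\<close>, since it is at most \<open>j\<close>; otherwise its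
  offset from \<open>a\<close> lies between \<open>\<theta>\<close> and \<open>0\<close>, hence in \<open>I\<close>.  So the sum only glues one translate of
  \<open>I\<close> to \<open>J\<close>.
\<close>

lemma mem_interval_from_plus_past_interval:
  assumes "past_interval I" and "interval_from a J"
  shows "t \<in> J + I \<longleftrightarrow> t \<in> J \<or> t - a \<in> I"
proof
  assume "t \<in> J + I"
  then obtain j \<theta> where j: "j \<in> J" "\<theta> \<in> I" "t = j + \<theta>"
    by (auto elim: set_plus_elim)
  have "\<theta> \<le> 0" "a \<le> j" using assms j by (auto simp: past_interval_def interval_from_def)
  show "t \<in> J \<or> t - a \<in> I"
  proof (cases "a \<le> t")
    case True
    moreover have "t \<le> j" using j \<open>\<theta> \<le> 0\<close> by simp
    ultimately have "t \<in> J"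
      using assms(2) j unfolding interval_from_def is_interval_1 by blast
    then show ?thesis by blast
  next
    case False
    then have "\<theta> \<le> t - a" "t - a \<le> 0" using j \<open>a \<le> j\<close> by auto
    then have "t - a \<in> I"
      using assms(1) j unfolding past_interval_def is_interval_1 by blast
    then show ?thesis by blast
  qed
next
  assume "t \<in> J \<or> t - a \<in> I"
  moreover have "t + 0 \<in> J + I" if "t \<in> J"
    using that assms(1) by (intro set_plus_intro) (auto simp: past_interval_def)
  moreover have "a + (t - a) \<in> J + I" if "t - a \<in> I"
    using that assms(2) by (intro set_plus_intro) (auto simp: interval_from_def)
  ultimately show "t \<in> J + I" by auto
qed

lemma interval_from_Icc: "0 \<le> \<tau> \<Longrightarrow> interval_from \<sigma> {\<sigma>..\<sigma> + \<tau>}"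
  by (auto simp: interval_from_def is_interval_1)

lemma interval_from_Ici: "interval_from a {a..}"
  by (auto simp: interval_from_def is_interval_1)

text \<open>
  The Lipschitz condition speaks only of pairs whose difference has compact support.  Two
  prolongations of the same history differ on \<open>[- s, 0]\<close> at most, but supports are taken relative to
  \<open>I\<close>, which need not be closed: for \<open>I = (-1, 0]\<close> and \<open>s \<ge> 1\<close> the support may fail to be compact.
  For short times this cannot happen, because \<open>I\<close> is either \<open>{0}\<close> or contains some \<open>[- r, 0]\<close>.
\<close>

lemma compact_supp_on_recent_past:
  assumes "past_interval I"
  obtains r where "r > 0"
    and "\<And>\<phi>. (\<And>\<theta>. \<theta> < -r \<Longrightarrow> \<phi> \<theta> = 0) \<Longrightarrow> compact (supp_on I \<phi>)"
proof (cases "I = {0}")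
  case True
  show ?thesis
  proof
    show "compact (supp_on I \<phi>)" for \<phi>
      by (rule finite_imp_compact) (simp add: supp_on_def True)
  qed (rule zero_less_one)
next
  case False
  then obtain \<theta>0 where \<theta>0: "\<theta>0 \<in> I" "\<theta>0 < 0"
    using assms by (force simp: past_interval_def)
  have sub: "{\<theta>0..0} \<subseteq> I"
    using assms \<theta>0 unfolding past_interval_def is_interval_1 by (meson atLeastAtMost_iff subsetI)
  show ?thesis
  proof
    show "- \<theta>0 > 0" using \<theta>0 by simp
    fix \<phi> :: "real \<Rightarrow> 'a" assume z: "\<And>\<theta>. \<theta> < - (- \<theta>0) \<Longrightarrow> \<phi> \<theta> = 0"
    have "{\<theta>\<in>I. \<phi> \<theta> \<noteq> 0} \<subseteq> {\<theta>0..0}"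
      using z assms by (force simp: past_interval_def not_less)
    then have c: "closure {\<theta>\<in>I. \<phi> \<theta> \<noteq> 0} \<subseteq> {\<theta>0..0}"
      by (rule closure_minimal) simp
    then have "supp_on I \<phi> = closure {\<theta>\<in>I. \<phi> \<theta> \<noteq> 0}"
      using sub unfolding supp_on_def by blast
    moreover have "compact (closure {\<theta>\<in>I. \<phi> \<theta> \<noteq> 0})"
      using c by (meson bounded_closed_interval bounded_subset closed_closure compact_eq_bounded_closed)
    ultimately show "compact (supp_on I \<phi>)" by simp
  qed
qed

section \<open>Prolongation by a prescribed velocity\<close>

text \<open>
  Time is shifted so that the history ends at \<open>0\<close>; the velocity \<open>u\<close> matters on the nonnegative reals
  only.
\<close>

definition prolong :: "(real \<Rightarrow> 'e::banach) \<Rightarrow> (real \<Rightarrow> 'e) \<Rightarrow> real \<Rightarrow> 'e" where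
  "prolong \<psi> u t = (if t < 0 then \<psi> t else \<psi> 0 + integral {0..t} u)"

text \<open>
  A map on \<open>[\<sigma>, \<sigma> + \<tau>] + I\<close> is represented by a function that vanishes elsewhere, so the
  prolongation has to be cut off after \<open>\<sigma> + \<tau>\<close>.
\<close>

definition prolong_until ::
  "real \<Rightarrow> real \<Rightarrow> (real \<Rightarrow> 'e::banach) \<Rightarrow> (real \<Rightarrow> 'e) \<Rightarrow> real \<Rightarrow> 'e" where
  "prolong_until \<sigma> \<tau> \<psi> u t = (if t \<le> \<sigma> + \<tau> then prolong \<psi> u (t - \<sigma>) else 0)"

lemma prolong_has_vector_derivative:
  assumes u: "continuous_on {0..} u" and "0 \<le> t"
  shows "(prolong \<psi> u has_vector_derivative u t) (at t within {0..})"
proof -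
  have "((\<lambda>r. integral {0..r} u) has_vector_derivative u t) (at t within {0..t+1})"
    using \<open>0 \<le> t\<close> by (intro integral_has_vector_derivative continuous_on_subset[OF u]) auto
  then have "((\<lambda>r. \<psi> 0 + integral {0..r} u) has_vector_derivative 0 + u t) (at t within {0..t+1})"
    by (intro has_vector_derivative_add has_vector_derivative_const)
  \<comment> \<open>The fundamental theorem needs a compact interval; near \<open>t\<close> the half-line looks the same.\<close>
  moreover have "at t within {0..t+1} = at t within {0..}"
    by (rule at_within_nhd[where S="{..<t+1}"]) auto
  ultimately have "((\<lambda>r. \<psi> 0 + integral {0..r} u) has_vector_derivative u t) (at t within {0..})"
    by simp
  then show ?thesis
    by (rule has_vector_derivative_transform[rotated 2]) (use \<open>0 \<le> t\<close> in \<open>auto simp: prolong_def\<close>)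
qed

lemma history_prolong_0:
  assumes "past_interval I" and "\<psi> \<in> maps_on I"
  shows "history I 0 (prolong \<psi> u) = \<psi>"
proof
  fix \<theta>
  show "history I 0 (prolong \<psi> u) \<theta> = \<psi> \<theta>"
    using assms by (cases "\<theta> = 0") (force simp: history_def prolong_def past_interval_def maps_on_def)+
qed

lemma history_prolong_until:
  assumes "past_interval I" and "t \<le> \<sigma> + \<tau>"
  shows "history I t (prolong_until \<sigma> \<tau> \<psi> u) = history I (t - \<sigma>) (prolong \<psi> u)"
proof
  fix \<theta>
  have "\<theta> \<in> I \<Longrightarrow> t + \<theta> \<le> \<sigma> + \<tau>"
    using assms by (force simp: past_interval_def)
  then show "history I t (prolong_until \<sigma> \<tau> \<psi> u) \<theta> = history I (t - \<sigma>) (prolong \<psi> u) \<theta>"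
    by (simp add: history_def prolong_until_def diff_add_eq)
qed

lemma history_prolong_until_start:
  assumes "past_interval I" and "\<psi> \<in> maps_on I" and "0 \<le> \<tau>"
  shows "history I \<sigma> (prolong_until \<sigma> \<tau> \<psi> u) = \<psi>"
  using history_prolong_until[of I \<sigma> \<sigma> \<tau> \<psi> u] history_prolong_0[of I \<psi> u] assms by simp

lemma prolong_until_has_vector_derivative:
  assumes u: "continuous_on {0..} u" and t: "t \<in> {\<sigma>..\<sigma> + \<tau>}"
  shows "(prolong_until \<sigma> \<tau> \<psi> u has_vector_derivative u (t - \<sigma>)) (at t within {\<sigma>..\<sigma> + \<tau>})"
proof -
  have "(prolong \<psi> u has_vector_derivative u (t - \<sigma>)) (at (t - \<sigma>) within (\<lambda>t. t - \<sigma>) ` {\<sigma>..\<sigma> + \<tau>})"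
    using t by (intro has_vector_derivative_within_subset[OF prolong_has_vector_derivative[OF u]]) auto
  moreover have "((\<lambda>t. t - \<sigma>) has_vector_derivative 1) (at t within {\<sigma>..\<sigma> + \<tau>})"
    by (auto intro!: derivative_eq_intros simp: has_vector_derivative_def)
  ultimately have "(prolong \<psi> u \<circ> (\<lambda>t. t - \<sigma>) has_vector_derivative 1 *\<^sub>R u (t - \<sigma>))
      (at t within {\<sigma>..\<sigma> + \<tau>})"
    by (intro vector_diff_chain_within) auto
  then have "(prolong \<psi> u \<circ> (\<lambda>t. t - \<sigma>) has_vector_derivative u (t - \<sigma>)) (at t within {\<sigma>..\<sigma> + \<tau>})"
    by simp
  then show ?thesis
    by (rule has_vector_derivative_transform[rotated 2]) (use t in \<open>auto simp: prolong_until_def\<close>)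
qed

lemma prolong_until_in_maps_on:
  assumes "past_interval I" and "\<psi> \<in> maps_on I" and "0 \<le> \<tau>"
  shows "prolong_until \<sigma> \<tau> \<psi> u \<in> maps_on ({\<sigma>..\<sigma> + \<tau>} + I)"
  using assms(2,3)
  by (auto simp: maps_on_def prolong_until_def prolong_def
      mem_interval_from_plus_past_interval[OF assms(1) interval_from_Icc])

lemma C1_prolongation_prolong:
  assumes "past_interval I" and "\<psi> \<in> maps_on I" and "continuous_on {0..} u"
  shows "C1_prolongation I 0 \<psi> {0..} (prolong \<psi> u)"
  unfolding C1_prolongation_def
proof (intro conjI)
  show "prolong \<psi> u \<in> maps_on ({0..} + I)"
    using assms(2)
    by (auto simp: maps_on_def prolong_def
        mem_interval_from_plus_past_interval[OF assms(1) interval_from_Ici])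
  show "C1_on {0..} (prolong \<psi> u)"
    unfolding C1_on_def using assms(3) prolong_has_vector_derivative[OF assms(3)] by auto
qed (simp_all add: interval_from_Ici history_prolong_0 assms)

lemma C1_on_prolong_until:
  assumes "continuous_on {0..} u"
  shows "C1_on {\<sigma>..\<sigma> + \<tau>} (prolong_until \<sigma> \<tau> \<psi> u)"
  unfolding C1_on_def
proof (intro exI[of _ "\<lambda>t. u (t - \<sigma>)"] conjI ballI)
  show "continuous_on {\<sigma>..\<sigma> + \<tau>} (\<lambda>t. u (t - \<sigma>))"
    by (rule continuous_on_compose2[OF assms]) (auto intro!: continuous_intros)
qed (rule prolong_until_has_vector_derivative[OF assms])

text \<open>
  The velocity determines the prolongation: on \<open>[\<sigma>, \<sigma> + \<tau>]\<close> both maps are antiderivatives of the same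
  function with the same value at \<open>\<sigma>\<close>, and elsewhere both are given by \<open>\<psi>\<close> or by the default value
  \<open>0\<close>.
\<close>

lemma eq_prolong_until:
  assumes I: "past_interval I" and "0 \<le> \<tau>" and u: "continuous_on {0..} u"
    and x: "x \<in> maps_on ({\<sigma>..\<sigma> + \<tau>} + I)" and h: "history I \<sigma> x = \<psi>"
    and D: "\<And>t. t \<in> {\<sigma>..\<sigma> + \<tau>} \<Longrightarrow>
      (x has_vector_derivative u (t - \<sigma>)) (at t within {\<sigma>..\<sigma> + \<tau>})"
  shows "x = prolong_until \<sigma> \<tau> \<psi> u"
proof
  fix t
  let ?p = "prolong_until \<sigma> \<tau> \<psi> u"
  have \<psi>: "\<psi> \<theta> = (if \<theta> \<in> I then x (\<sigma> + \<theta>) else 0)" for \<theta>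
    using h by (auto simp: history_def)
  consider "t < \<sigma>" | "t \<in> {\<sigma>..\<sigma> + \<tau>}" | "\<sigma> + \<tau> < t" by fastforce
  then show "x t = ?p t"
  proof cases
    case 1
    then have "?p t = \<psi> (t - \<sigma>)" using \<open>0 \<le> \<tau>\<close> by (auto simp: prolong_until_def prolong_def)
    moreover have "x t = 0" if "t - \<sigma> \<notin> I"
      using x that 1 mem_interval_from_plus_past_interval[OF I interval_from_Icc[OF \<open>0 \<le> \<tau>\<close>], of t]
      by (auto simp: maps_on_def)
    ultimately show ?thesis by (simp add: \<psi>)
  next
    case 2
    have "((\<lambda>r. u (r - \<sigma>)) has_integral x t - x \<sigma>) {\<sigma>..t}"
      using 2 by (intro fundamental_theorem_of_calculus)
        (auto intro: has_vector_derivative_within_subset[OF D])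
    moreover have "((\<lambda>r. u (r - \<sigma>)) has_integral ?p t - ?p \<sigma>) {\<sigma>..t}"
      using 2 by (intro fundamental_theorem_of_calculus)
        (auto intro: has_vector_derivative_within_subset[OF prolong_until_has_vector_derivative[OF u]])
    ultimately have "x t - x \<sigma> = ?p t - ?p \<sigma>" by (rule has_integral_unique)
    moreover have "?p \<sigma> = x \<sigma>"
      using \<psi>[of 0] I \<open>0 \<le> \<tau>\<close> by (simp add: prolong_until_def prolong_def past_interval_def)
    ultimately show ?thesis by simp
  next
    case 3
    then have "t \<notin> {\<sigma>..\<sigma> + \<tau>} + I"
      using I \<open>0 \<le> \<tau>\<close>
      by (auto simp: mem_interval_from_plus_past_interval[OF I interval_from_Icc] past_interval_def)
    then show ?thesis using x 3 by (simp add: maps_on_def prolong_until_def)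
  qed
qed

lemma norm_integral_le_on_initial_segment:
  fixes u :: "real \<Rightarrow> 'e::banach"
  assumes u: "continuous_on {0..} u" and "0 \<le> t" "t \<le> s"
    and b: "\<And>r. r \<in> {0..s} \<Longrightarrow> norm (u r) \<le> b"
  shows "norm (integral {0..t} u) \<le> s * b"
proof -
  have "norm (integral {0..t} u) \<le> b * (t - 0)"
    using assms by (intro integral_bound continuous_on_subset[OF u]) auto
  also have "\<dots> \<le> b * s"
    using assms order_trans[OF norm_ge_zero b[of 0]] by (intro mult_mono) auto
  finally show ?thesis by (simp add: mult.commute)
qed

text \<open>
  The bound is imposed on \<open>[0, s]\<close> only, because the history at time \<open>s\<close> depends on the velocity up to
  \<open>s\<close> only.  This is what makes the first-exit argument for solutions possible.
\<close>

definition admissible_velocity :: "'e::banach \<Rightarrow> real \<Rightarrow> real \<Rightarrow> (real \<Rightarrow> 'e) \<Rightarrow> bool" where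
  "admissible_velocity v \<eta> s u \<longleftrightarrow>
     continuous_on {0..} u \<and> u 0 = v \<and> (\<forall>r\<in>{0..s}. norm (u r - v) \<le> \<eta>)"

text \<open>
  Subtracting the linear prolongation leaves the primitive of \<open>u - v\<close>: its values are at most
  \<open>\<tau> * \<eta>\<close> and its derivative \<open>u - v\<close> is at most \<open>\<eta>\<close>, which add up to the radius \<open>(1 + \<tau>) * \<eta>\<close>.
\<close>

lemma prolong_until_in_Gamma1:
  assumes I: "past_interval I" and \<psi>: "\<psi> \<in> maps_on I" and "0 < \<tau>"
    and u: "admissible_velocity v \<eta> \<tau> u" and \<delta>: "ennreal ((1 + \<tau>) * \<eta>) \<le> \<delta>"
  shows "prolong_until \<sigma> \<tau> \<psi> u \<in> Gamma1 I \<sigma> \<psi> \<tau> \<delta> v"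
proof -
  let ?p = "prolong_until \<sigma> \<tau> \<psi> u"
  let ?g = "\<lambda>t. ?p (\<sigma> + t) - linear_prolongation \<psi> v t"
  have uc: "continuous_on {0..} u" and u0: "u 0 = v"
    and ub: "\<And>r. r \<in> {0..\<tau>} \<Longrightarrow> norm (u r - v) \<le> \<eta>"
    using u by (auto simp: admissible_velocity_def)
  have "0 \<le> \<eta>" using ub[of 0] \<open>0 < \<tau>\<close> u0 by simp
  have uvc: "continuous_on {0..} (\<lambda>r. u r - v)" by (intro continuous_intros uc)
  have g: "?g t = integral {0..t} (\<lambda>r. u r - v)" if "t \<in> {0..\<tau>}" for t
  proof -
    have "u integrable_on {0..t}"
      by (intro integrable_continuous_interval continuous_on_subset[OF uc]) auto
    then have "integral {0..t} (\<lambda>r. u r - v) = integral {0..t} u - t *\<^sub>R v"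
      using that by (subst integral_diff) auto
    then show ?thesis using that by (simp add: prolong_until_def prolong_def linear_prolongation_def)
  qed
  have g': "vector_derivative ?g (at t within {0..\<tau>}) = u t - v" if t: "t \<in> {0..\<tau>}" for t
  proof -
    have "((\<lambda>t. integral {0..t} (\<lambda>r. u r - v)) has_vector_derivative u t - v) (at t within {0..\<tau>})"
      using t by (intro integral_has_vector_derivative continuous_on_subset[OF uvc]) auto
    then have "(?g has_vector_derivative u t - v) (at t within {0..\<tau>})"
      by (rule has_vector_derivative_transform[OF t g, rotated])
    then show ?thesis
      using vector_derivative_within_cbox[of 0 \<tau> t] t \<open>0 < \<tau>\<close> by simp
  qed
  have "C1_norm \<tau> ?g \<le> ennreal (\<tau> * \<eta>) + ennreal \<eta>"
    unfolding C1_norm_def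
  proof (intro add_mono SUP_least ennreal_leI)
    fix t assume t: "t \<in> {0..\<tau>}"
    show "norm (?g t) \<le> \<tau> * \<eta>"
      unfolding g[OF t] using t
      by (intro norm_integral_le_on_initial_segment[OF uvc]) (auto intro: ub)
    show "norm (vector_derivative ?g (at t within {0..\<tau>})) \<le> \<eta>"
      using t ub by (simp add: g')
  qed
  also have "\<dots> = ennreal ((1 + \<tau>) * \<eta>)"
    using \<open>0 < \<tau>\<close> \<open>0 \<le> \<eta>\<close> by (simp add: ennreal_plus[symmetric] algebra_simps del: ennreal_plus)
  finally have "C1_norm \<tau> ?g \<le> \<delta>" using \<delta> by (rule order_trans)
  moreover have "C1_prolongation I \<sigma> \<psi> {\<sigma>..\<sigma> + \<tau>} ?p"
    using assms(1-3) uc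
    by (simp add: C1_prolongation_def interval_from_Icc prolong_until_in_maps_on
        history_prolong_until_start C1_on_prolong_until)
  moreover have "(?p has_vector_derivative v) (at_right \<sigma>)"
    using prolong_until_has_vector_derivative[OF uc, of \<sigma> \<sigma> \<tau> \<psi>] u0 \<open>0 < \<tau>\<close>
    by (simp add: at_within_Icc_at_right)
  ultimately show ?thesis using \<open>0 < \<tau>\<close> by (simp add: Gamma1_def)
qed

text \<open>
  The length \<open>0\<close> is a separate case, since there \<open>Gamma1\<close> consists of the translated history alone.
\<close>

lemma history_prolong_in_Lambda1:
  assumes I: "past_interval I" and \<psi>: "\<psi> \<in> maps_on I" and s: "s \<in> {0..T}"
    and u: "admissible_velocity v \<eta> s u" and \<delta>: "ennreal ((1 + s) * \<eta>) \<le> \<delta>"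
  shows "(\<sigma> + s, history I s (prolong \<psi> u)) \<in> Lambda1 I \<sigma> \<psi> T \<delta> v"
proof -
  have "\<exists>\<gamma>\<in>Gamma1 I \<sigma> \<psi> s \<delta> v. history I (\<sigma> + s) \<gamma> = history I s (prolong \<psi> u)"
  proof (cases "s = 0")
    case True
    have "history I \<sigma> (\<lambda>t. \<psi> (t - \<sigma>)) = \<psi>"
      using \<psi> by (auto simp: history_def maps_on_def)
    then show ?thesis using True history_prolong_0[OF I \<psi>] by (simp add: Gamma1_def)
  next
    case False
    then have "prolong_until \<sigma> s \<psi> u \<in> Gamma1 I \<sigma> \<psi> s \<delta> v"
      using s by (intro prolong_until_in_Gamma1[OF I \<psi> _ u \<delta>]) auto
    then show ?thesis using history_prolong_until[OF I, of "\<sigma> + s" \<sigma> s] by auto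
  qed
  then show ?thesis using s by (force simp: Lambda1_def)
qed

text \<open>
  This is where prolongability enters: the history moves continuously in the space of histories, so
  \<open>F\<close> along it is continuous in time.
\<close>

lemma continuous_on_F_history_prolong:
  fixes F :: "real \<times> (real \<Rightarrow> 'e::banach) \<Rightarrow> 'e"
  assumes I: "past_interval I" and X: "C1_prolongable I X"
    and \<psi>: "\<psi> \<in> topspace X" "\<psi> \<in> maps_on I"
    and F: "continuous_map (subtopology (prod_topology euclideanreal X) D) euclidean F"
    and u: "continuous_on {0..} u"
    and D: "\<And>s. s \<in> {0..T} \<Longrightarrow> (\<sigma> + s, history I s (prolong \<psi> u)) \<in> D"
  shows "continuous_on {0..T} (\<lambda>s. F (\<sigma> + s, history I s (prolong \<psi> u)))"
proof -
  have "continuous_map (top_of_set {0..}) X (\<lambda>s. history I s (prolong \<psi> u))"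
    using X \<psi> C1_prolongation_prolong[OF I \<psi>(2) u] unfolding C1_prolongable_def by blast
  then have "continuous_map (top_of_set {0..T}) X (\<lambda>s. history I s (prolong \<psi> u))"
    by (rule continuous_map_from_subtopology_mono) auto
  moreover have "continuous_map (top_of_set {0..T}) euclideanreal (\<lambda>s. \<sigma> + s)"
    by (auto intro!: continuous_intros)
  ultimately have "continuous_map (top_of_set {0..T}) (subtopology (prod_topology euclideanreal X) D)
      (\<lambda>s. (\<sigma> + s, history I s (prolong \<psi> u)))"
    using D by (auto simp: continuous_map_in_subtopology continuous_map_pairwise o_def)
  from continuous_map_compose[OF this F] show ?thesis by (simp add: o_def)
qed

text \<open>
  The two histories agree before the initial time, and after it they differ by the integral of
  \<open>u - w\<close> over an interval of length at most \<open>s\<close>.  The factor \<open>s\<close> is what makes the iteration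
  contract for short times.
\<close>

lemma sup_norm_history_prolong_diff_le:
  assumes u: "continuous_on {0..} u" and w: "continuous_on {0..} w" and "0 \<le> s" "0 \<le> d"
    and I: "past_interval I" and d: "\<And>r. r \<in> {0..s} \<Longrightarrow> norm (u r - w r) \<le> d"
  shows "sup_norm_on I (\<lambda>\<theta>. history I s (prolong \<psi> u) \<theta> - history I s (prolong \<psi> w) \<theta>)
    \<le> ennreal (s * d)"
  unfolding sup_norm_on_def
proof (intro SUP_least ennreal_leI)
  fix \<theta> assume "\<theta> \<in> I"
  then have "\<theta> \<le> 0" using I by (auto simp: past_interval_def)
  have "norm (prolong \<psi> u (s + \<theta>) - prolong \<psi> w (s + \<theta>)) \<le> s * d"
  proof (cases "s + \<theta> < 0")
    case False
    have *: "f integrable_on {0..s + \<theta>}" if "continuous_on {0..} f" for f :: "real \<Rightarrow> 'a"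
      by (intro integrable_continuous_interval continuous_on_subset[OF that]) auto
    have "prolong \<psi> u (s + \<theta>) - prolong \<psi> w (s + \<theta>) = integral {0..s + \<theta>} (\<lambda>r. u r - w r)"
      using False by (simp add: prolong_def integral_diff * u w)
    also have "norm \<dots> \<le> s * d"
      using False \<open>\<theta> \<le> 0\<close> d
      by (intro norm_integral_le_on_initial_segment) (auto intro!: continuous_intros u w)
    finally show ?thesis .
  qed (simp add: prolong_def \<open>0 \<le> s\<close> \<open>0 \<le> d\<close>)
  then show "norm (history I s (prolong \<psi> u) \<theta> - history I s (prolong \<psi> w) \<theta>) \<le> s * d"
    using \<open>\<theta> \<in> I\<close> by (simp add: history_def)
qed

section \<open>Picard iteration on velocities\<close>

text \<open>
  The setting collects what the iteration needs from the rectangles, the Lipschitz condition and the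
  continuity of \<open>F\<close>, expressed through velocities.  The bound \<open>1 / 4\<close> for \<open>L * T\<close> and the
  bound \<open>\<eta> / 2\<close> for the drift along the linear prolongation leave the margin \<open>\<eta> / 4\<close> that yields
  strict inequalities below.
\<close>

locale retarded_picard =
  fixes I :: "real set" and D :: "(real \<times> (real \<Rightarrow> 'e::banach)) set"
    and F :: "real \<times> (real \<Rightarrow> 'e) \<Rightarrow> 'e"
    and t0 :: real and \<phi> :: "real \<Rightarrow> 'e" and T L \<eta> :: real
  assumes past_interval: "past_interval I" and initial: "\<phi> \<in> maps_on I"
    and T: "0 < T" and \<eta>: "0 < \<eta>" and L: "0 \<le> L" and LT: "L * T \<le> 1 / 4"
    and in_domain: "\<lbrakk>s \<in> {0..T}; admissible_velocity (F (t0, \<phi>)) \<eta> s u\<rbrakk>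
      \<Longrightarrow> (t0 + s, history I s (prolong \<phi> u)) \<in> D"
    and Lipschitz: "\<lbrakk>s \<in> {0..T};
        admissible_velocity (F (t0, \<phi>)) \<eta> s u; admissible_velocity (F (t0, \<phi>)) \<eta> s w;
        0 \<le> d; \<And>r. r \<in> {0..s} \<Longrightarrow> norm (u r - w r) \<le> d\<rbrakk>
      \<Longrightarrow> norm (F (t0 + s, history I s (prolong \<phi> u)) - F (t0 + s, history I s (prolong \<phi> w)))
        \<le> L * (s * d)"
    and continuous: "\<lbrakk>continuous_on {0..} u;
        \<And>s. s \<in> {0..T} \<Longrightarrow> (t0 + s, history I s (prolong \<phi> u)) \<in> D\<rbrakk>
      \<Longrightarrow> continuous_on {0..T} (\<lambda>s. F (t0 + s, history I s (prolong \<phi> u)))"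
    and drift: "s \<in> {0..T} \<Longrightarrow>
      norm (F (t0 + s, history I s (prolong \<phi> (\<lambda>_. F (t0, \<phi>)))) - F (t0, \<phi>)) \<le> \<eta> / 2"
begin

abbreviation v0 :: 'e where "v0 \<equiv> F (t0, \<phi>)"

text \<open>The velocity that the differential equation prescribes to the prolongation by \<open>u\<close>.\<close>

definition feedback :: "(real \<Rightarrow> 'e) \<Rightarrow> real \<Rightarrow> 'e" where
  "feedback u s = F (t0 + s, history I s (prolong \<phi> u))"

text \<open>
  Velocities on \<open>[0, T]\<close> are represented by bounded continuous functions on the whole line, whose
  supremum metric is complete.  In the fixed point equation they are extended constantly beyond
  \<open>[0, T]\<close> by means of \<open>clamp\<close>.
\<close>

definition velocities :: "(real \<Rightarrow>\<^sub>C 'e) set" where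
  "velocities = PiC UNIV (\<lambda>t. if t = 0 then {v0} else cball v0 \<eta>)"

lemma mem_velocities_iff:
  "u \<in> velocities \<longleftrightarrow> apply_bcontfun u 0 = v0 \<and> (\<forall>t. norm (apply_bcontfun u t - v0) \<le> \<eta>)"
proof -
  have "u \<in> velocities \<longleftrightarrow> (\<forall>t. apply_bcontfun u t \<in> (if t = 0 then {v0} else cball v0 \<eta>))"
    by (simp add: velocities_def mem_PiC_iff Pi_iff)
  also have "\<dots> \<longleftrightarrow> apply_bcontfun u 0 = v0 \<and> (\<forall>t. norm (apply_bcontfun u t - v0) \<le> \<eta>)"
    using \<eta> by (simp add: mem_cball dist_norm norm_minus_commute) (metis diff_self norm_zero less_imp_le)
  finally show ?thesis .
qed

lemma admissible_velocities: "u \<in> velocities \<Longrightarrow> admissible_velocity v0 \<eta> s (apply_bcontfun u)"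
  by (simp add: mem_velocities_iff admissible_velocity_def)

lemma feedback_0: "feedback u 0 = v0"
  by (simp add: feedback_def history_prolong_0 past_interval initial)

lemma Lipschitz_const:
  assumes "s \<in> {0..T}" "0 \<le> d" shows "L * (s * d) \<le> d / 4"
proof -
  have "L * s \<le> L * T" using assms L by (intro mult_left_mono) auto
  then have "L * s * d \<le> 1 / 4 * d" using LT assms by (intro mult_right_mono) auto
  then show ?thesis by (simp add: mult.assoc)
qed

text \<open>
  Comparison with the linear prolongation, whose velocity is constantly \<open>v0\<close>: the Lipschitz condition
  contributes at most \<open>\<eta> / 4\<close> and the drift at most \<open>\<eta> / 2\<close>.
\<close>

lemma feedback_near_initial_velocity:
  assumes s: "s \<in> {0..T}" and u: "admissible_velocity v0 \<eta> s u"
  shows "norm (feedback u s - v0) < \<eta>"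
proof -
  have "norm (feedback u s - feedback (\<lambda>_. v0) s) \<le> L * (s * \<eta>)"
    unfolding feedback_def using u \<eta>
    by (intro Lipschitz[OF s u]) (auto simp: admissible_velocity_def)
  also have "\<dots> \<le> \<eta> / 4" using Lipschitz_const[OF s] \<eta> by simp
  finally have "norm (feedback u s - feedback (\<lambda>_. v0) s) \<le> \<eta> / 4" .
  moreover have "norm (feedback (\<lambda>_. v0) s - v0) \<le> \<eta> / 2"
    using drift[OF s] by (simp add: feedback_def)
  ultimately show ?thesis
    using norm_triangle_ineq[of "feedback u s - feedback (\<lambda>_. v0) s" "feedback (\<lambda>_. v0) s - v0"] \<eta>
    by simp
qed

lemma feedback_fixed_point:
  "\<exists>!u\<in>velocities. \<forall>t. apply_bcontfun u t = feedback (apply_bcontfun u) (clamp 0 T t)"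
proof -
  have clamp: "clamp 0 T t \<in> {0..T}" for t :: real
    using clamp_in_interval[of 0 T t] T by simp
  have clamp0: "clamp 0 T (0::real) = 0" using clamp_cancel_cbox[of 0 0 T] T by simp
  have "\<exists>w. w \<in> velocities \<and> (\<forall>t. apply_bcontfun w t = feedback (apply_bcontfun u) (clamp 0 T t))"
    if u: "u \<in> velocities" for u
  proof -
    have "continuous_on (cbox 0 T) (feedback (apply_bcontfun u))"
      unfolding feedback_def box_real
      by (intro continuous in_domain admissible_velocities[OF u]) auto
    then obtain w where w: "\<And>t. apply_bcontfun w t = feedback (apply_bcontfun u) (clamp 0 T t)"
      by (rule continuous_on_cbox_bcontfunE) blast
    have "w \<in> velocities"
      using feedback_near_initial_velocity[OF clamp admissible_velocities[OF u]]
      by (simp add: mem_velocities_iff w clamp0 feedback_0 less_imp_le)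
    then show ?thesis using w by blast
  qed
  then obtain \<Phi> where \<Phi>: "\<And>u. u \<in> velocities \<Longrightarrow> \<Phi> u \<in> velocities"
    and \<Phi>_eq: "\<And>u t. u \<in> velocities \<Longrightarrow>
      apply_bcontfun (\<Phi> u) t = feedback (apply_bcontfun u) (clamp 0 T t)"
    by metis
  have "\<exists>!u\<in>velocities. \<Phi> u = u"
  proof (rule Banach_fix[where c="1/4"])
    show "complete velocities"
      unfolding velocities_def complete_eq_closed by (intro closed_PiC) auto
    show "velocities \<noteq> {}"
      using \<eta> mem_velocities_iff[of "const_bcontfun v0"] by auto
    fix u w assume u: "u \<in> velocities" and w: "w \<in> velocities"
    show "dist (\<Phi> u) (\<Phi> w) \<le> 1 / 4 * dist u w"
    proof (rule dist_bound)
      fix t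
      have "dist (apply_bcontfun (\<Phi> u) t) (apply_bcontfun (\<Phi> w) t)
          \<le> L * (clamp 0 T t * dist u w)"
        unfolding \<Phi>_eq[OF u] \<Phi>_eq[OF w] feedback_def
        by (subst dist_norm, intro Lipschitz[OF clamp] admissible_velocities u w)
          (auto simp: dist_norm[symmetric] dist_bounded)
      also have "\<dots> \<le> 1 / 4 * dist u w" using Lipschitz_const[OF clamp, of "dist u w"] by simp
      finally show "dist (apply_bcontfun (\<Phi> u) t) (apply_bcontfun (\<Phi> w) t) \<le> 1 / 4 * dist u w" .
    qed
  qed (use \<Phi> in auto)
  moreover have "\<Phi> u = u \<longleftrightarrow> (\<forall>t. apply_bcontfun u t = feedback (apply_bcontfun u) (clamp 0 T t))"
    if "u \<in> velocities" for u
    using \<Phi>_eq[OF that] by (metis bcontfun_eqI)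
  ultimately show ?thesis by metis
qed

text \<open>
  At a first time \<open>m\<close> with \<open>\<parallel>u m - v0\<parallel> \<ge> \<eta>\<close> the velocity would still be admissible up to \<open>m\<close>, and then
  the equation forces \<open>\<parallel>u m - v0\<parallel> < \<eta>\<close>.
\<close>

lemma solution_velocity_near_initial_velocity:
  assumes u: "continuous_on {0..} u" and fp: "\<And>s. s \<in> {0..T} \<Longrightarrow> u s = feedback u s"
    and s: "s \<in> {0..T}"
  shows "norm (u s - v0) \<le> \<eta>"
proof (rule ccontr)
  assume *: "\<not> norm (u s - v0) \<le> \<eta>"
  define A where "A = {r\<in>{0..T}. \<eta> \<le> norm (u r - v0)}"
  have "continuous_on {0..T} (\<lambda>r. norm (u r - v0))"
    by (intro continuous_intros continuous_on_subset[OF u]) auto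
  then have "closed A"
    unfolding A_def by (intro continuous_on_closed_Collect_le) (auto intro: continuous_intros)
  moreover have "A \<noteq> {}" using s * by (auto simp: A_def)
  moreover have "bdd_below A" by (auto simp: A_def intro: bdd_belowI[of _ 0])
  ultimately have m: "Inf A \<in> A" by (intro closed_contains_Inf)
  define m where "m = Inf A"
  have mA: "m \<in> {0..T}" "\<eta> \<le> norm (u m - v0)" using m by (auto simp: A_def m_def)
  have u0: "u 0 = v0" using fp[of 0] T feedback_0 by simp
  then have "0 < m" using mA \<eta> by (cases "m = 0") auto
  have before: "norm (u r - v0) \<le> \<eta>" if "r \<in> {0..<m}" for r
  proof (rule ccontr)
    assume "\<not> norm (u r - v0) \<le> \<eta>"
    then have "r \<in> A" using that mA by (auto simp: A_def)
    then show False using \<open>bdd_below A\<close> cInf_lower[of r A] that by (simp add: m_def)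
  qed
  \<comment> \<open>The bound before \<open>m\<close> passes to \<open>m\<close> itself by continuity.\<close>
  have "closed {r\<in>{0..m}. norm (u r - v0) \<le> \<eta>}"
    by (intro continuous_on_closed_Collect_le continuous_intros continuous_on_subset[OF u]) auto
  then have "closure {0..<m} \<subseteq> {r\<in>{0..m}. norm (u r - v0) \<le> \<eta>}"
    using before by (intro closure_minimal) auto
  then have "admissible_velocity v0 \<eta> m u"
    using \<open>0 < m\<close> u u0 by (auto simp: admissible_velocity_def)
  then have "norm (u m - v0) < \<eta>"
    using feedback_near_initial_velocity[OF mA(1)] fp[OF mA(1)] by simp
  then show False using mA(2) by simp
qed

lemma C1_solution_of_fixed_point:
  assumes u: "u \<in> velocities"
    and fp: "\<And>t. apply_bcontfun u t = feedback (apply_bcontfun u) (clamp 0 T t)"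
  shows "C1_solution I D F t0 \<phi> {t0..t0 + T} (prolong_until t0 T \<phi> (apply_bcontfun u))"
proof -
  let ?u = "apply_bcontfun u" and ?x = "prolong_until t0 T \<phi> (apply_bcontfun u)"
  have c: "continuous_on {0..} ?u" by simp
  have "(t, history I t ?x) \<in> D \<and>
      (?x has_vector_derivative F (t, history I t ?x)) (at t within {t0..t0 + T})"
    if t: "t \<in> {t0..t0 + T}" for t
  proof -
    have h: "history I t ?x = history I (t - t0) (prolong \<phi> ?u)"
      using t by (intro history_prolong_until past_interval) auto
    have "?u (t - t0) = feedback ?u (t - t0)"
      using fp[of "t - t0"] clamp_cancel_cbox[of "t - t0" 0 T] t by simp
    then have "?u (t - t0) = F (t, history I t ?x)" by (simp add: feedback_def h)
    moreover have "(t0 + (t - t0), history I (t - t0) (prolong \<phi> ?u)) \<in> D"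
      using t by (intro in_domain admissible_velocities[OF u]) auto
    ultimately show ?thesis
      using prolong_until_has_vector_derivative[OF c t, of \<phi>] h by simp
  qed
  then show ?thesis
    using T past_interval initial
    by (simp add: C1_solution_def ivp_solution_def interval_from_Icc prolong_until_in_maps_on
        history_prolong_until_start C1_on_prolong_until[OF c])
qed

text \<open>
  The velocity of a \<open>C\<^sup>1\<close>-solution is continuous by definition and agrees with the right-hand side of
  the equation by uniqueness of derivatives; the bound on solutions places it in \<open>velocities\<close>.
\<close>

lemma fixed_point_of_C1_solution:
  assumes x: "C1_solution I D F t0 \<phi> {t0..t0 + T} x"
  obtains u where "u \<in> velocities" "x = prolong_until t0 T \<phi> (apply_bcontfun u)"
    and "\<And>t. apply_bcontfun u t = feedback (apply_bcontfun u) (clamp 0 T t)"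
proof -
  let ?J = "{t0..t0 + T}"
  have xD: "(x has_vector_derivative F (t, history I t x)) (at t within ?J)" if "t \<in> ?J" for t
    using x that by (auto simp: C1_solution_def ivp_solution_def)
  obtain x' where x': "continuous_on ?J x'"
    "\<And>t. t \<in> ?J \<Longrightarrow> (x has_vector_derivative x' t) (at t within ?J)"
    using x by (auto simp: C1_solution_def C1_on_def)
  have "F (t, history I t x) = x' t" if "t \<in> ?J" for t
    using T that xD[OF that] x'(2)[OF that]
    by (intro vector_derivative_unique_within_closed_interval[of t0 "t0 + T" t x]) auto
  then have "continuous_on ?J (\<lambda>t. F (t, history I t x))"
    using x'(1) continuous_on_cong[of ?J ?J "\<lambda>t. F (t, history I t x)" x'] by blast
  then have "continuous_on (cbox 0 T) (\<lambda>s. F (t0 + s, history I (t0 + s) x))"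
    by (rule continuous_on_compose2) (auto intro!: continuous_intros)
  then obtain u where u: "\<And>s. s \<in> cbox 0 T \<Longrightarrow> apply_bcontfun u s = F (t0 + s, history I (t0 + s) x)"
    and uc: "\<And>s. apply_bcontfun u s = F (t0 + clamp 0 T s, history I (t0 + clamp 0 T s) x)"
    by (rule continuous_on_cbox_bcontfunE) blast
  let ?u = "apply_bcontfun u"
  have xu: "x = prolong_until t0 T \<phi> ?u"
  proof (rule eq_prolong_until[OF past_interval])
    fix t assume t: "t \<in> ?J"
    then show "(x has_vector_derivative ?u (t - t0)) (at t within ?J)"
      using xD[OF t] u[of "t - t0"] by simp
  qed (use x T in \<open>auto simp: C1_solution_def ivp_solution_def\<close>)
  have h: "history I (t0 + s) x = history I s (prolong \<phi> ?u)" if "s \<in> {0..T}" for s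
    using history_prolong_until[OF past_interval, of "t0 + s" t0 T \<phi> ?u] that xu by simp
  have clamp: "clamp 0 T t \<in> {0..T}" for t :: real
    using clamp_in_interval[of 0 T t] T by simp
  have fp: "?u t = feedback ?u (clamp 0 T t)" for t
    using uc h[OF clamp] by (simp add: feedback_def)
  have fp': "?u s = feedback ?u s" if "s \<in> {0..T}" for s
    using u h that by (simp add: feedback_def)
  \<comment> \<open>The bound is known on \<open>[0, T]\<close>; the constant extension carries it to all times.\<close>
  have "?u t = ?u (clamp 0 T t)" for t
    using fp fp'[OF clamp] by simp
  then have "u \<in> velocities"
    using solution_velocity_near_initial_velocity[OF _ fp' clamp] fp'[of 0] T
    by (simp add: mem_velocities_iff feedback_0)
  then show ?thesis using xu fp by (rule that)
qed

theorem unique_C1_solution: "\<exists>!x. C1_solution I D F t0 \<phi> {t0..t0 + T} x"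
proof -
  obtain u where u: "u \<in> velocities"
      "\<And>t. apply_bcontfun u t = feedback (apply_bcontfun u) (clamp 0 T t)"
    and unique: "\<And>w. \<lbrakk>w \<in> velocities; \<And>t. apply_bcontfun w t = feedback (apply_bcontfun w) (clamp 0 T t)\<rbrakk>
      \<Longrightarrow> w = u"
    using feedback_fixed_point by blast
  show ?thesis
  proof
    show "C1_solution I D F t0 \<phi> {t0..t0 + T} (prolong_until t0 T \<phi> (apply_bcontfun u))"
      by (rule C1_solution_of_fixed_point[OF u])
    show "x = prolong_until t0 T \<phi> (apply_bcontfun u)"
      if "C1_solution I D F t0 \<phi> {t0..t0 + T} x" for x
      using fixed_point_of_C1_solution[OF that] unique by metis
  qed
qed

end

section \<open>Choice of the time span\<close>

text \<open>
  The radius \<open>\<eta>\<close> is fixed before the time span.  It is half of a finite radius \<open>\<delta>\<close> that is admissible for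
  both the domain and the Lipschitz condition, so that \<open>(1 + s) * \<eta> \<le> \<delta>\<close> for \<open>s \<le> 1\<close>.  The drift along
  the linear prolongation depends on \<open>s\<close> alone, so it can be brought below \<open>\<eta> / 2\<close> by shortening
  the time span without touching \<open>\<eta>\<close>.
\<close>

theorem theorem2:
  fixes I :: "real set"
    and X :: "(real \<Rightarrow> 'e::banach) topology"
    and D :: "(real \<times> (real \<Rightarrow> 'e)) set"
    and F :: "real \<times> (real \<Rightarrow> 'e) \<Rightarrow> 'e"
    and t\<^sub>0 :: real
    and \<phi>\<^sub>0 :: "real \<Rightarrow> 'e"
  assumes "past_interval I"
    and "history_space I X"
    and "D \<subseteq> UNIV \<times> topspace X"
    and "(t\<^sub>0, \<phi>\<^sub>0) \<in> D"
    and "C1_prolongable I X"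
    and "regulated_by_C1_prolongations I X"
    and "continuous_map (subtopology (prod_topology euclideanreal X) D) euclidean F"
    and "neighborhood_by_C1_prolongations I D t\<^sub>0 \<phi>\<^sub>0"
    and "locally_Lipschitz_about_C1_prolongations I D F t\<^sub>0 \<phi>\<^sub>0"
  shows "\<exists>T>0. \<exists>!x. C1_solution I D F t\<^sub>0 \<phi>\<^sub>0 {t\<^sub>0..t\<^sub>0 + T} x"
proof -
  let ?v = "F (t\<^sub>0, \<phi>\<^sub>0)"
  let ?h = "\<lambda>u s. history I s (prolong \<phi>\<^sub>0 u)"
  note I = assms(1) and F = assms(7)
  have \<phi>X: "\<phi>\<^sub>0 \<in> topspace X" using assms(3,4) by auto
  then have \<phi>I: "\<phi>\<^sub>0 \<in> maps_on I" using assms(2) by (auto simp: history_space_def)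
  obtain T1 \<delta>1 where T1: "T1 > 0" "\<delta>1 > 0" "Lambda1 I t\<^sub>0 \<phi>\<^sub>0 T1 \<delta>1 ?v \<subseteq> D"
    using assms(8) unfolding neighborhood_by_C1_prolongations_def by blast
  obtain T2 \<delta>2 L where T2: "T2 > 0" "\<delta>2 > 0" "L > 0"
    and Lip: "\<And>t \<phi> \<psi>. \<lbrakk>(t, \<phi>) \<in> Lambda1 I t\<^sub>0 \<phi>\<^sub>0 T2 \<delta>2 ?v \<inter> D; (t, \<psi>) \<in> Lambda1 I t\<^sub>0 \<phi>\<^sub>0 T2 \<delta>2 ?v \<inter> D;
        compact (supp_on I (\<lambda>\<theta>. \<phi> \<theta> - \<psi> \<theta>))\<rbrakk>
      \<Longrightarrow> ennreal (norm (F (t, \<phi>) - F (t, \<psi>))) \<le> ennreal L * sup_norm_on I (\<lambda>\<theta>. \<phi> \<theta> - \<psi> \<theta>)"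
    using assms(9) unfolding locally_Lipschitz_about_C1_prolongations_def by blast
  obtain r where r: "r > 0"
    "\<And>\<phi>::real \<Rightarrow> 'e. (\<And>\<theta>. \<theta> < -r \<Longrightarrow> \<phi> \<theta> = 0) \<Longrightarrow> compact (supp_on I \<phi>)"
    using compact_supp_on_recent_past[OF I, where 'a='e] by blast
  have "min \<delta>1 \<delta>2 > 0" using T1 T2 by simp
  then obtain e where e: "0 < e" "e < min \<delta>1 \<delta>2" using dense by blast
  obtain \<delta> where "0 < \<delta>" and \<delta>: "ennreal \<delta> \<le> \<delta>1" "ennreal \<delta> \<le> \<delta>2"
  proof
    have "e < top" using e by (meson less_le_trans top_greatest)
    then show "0 < enn2real e" using e by (simp add: enn2real_positive_iff)
    show "ennreal (enn2real e) \<le> \<delta>1" "ennreal (enn2real e) \<le> \<delta>2"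
      using e \<open>e < top\<close> by (simp_all add: less_imp_le)
  qed
  define \<eta> where "\<eta> = \<delta> / 2"
  have "0 < \<eta>" using \<open>0 < \<delta>\<close> by (simp add: \<eta>_def)
  have radius: "ennreal ((1 + s) * \<eta>) \<le> \<delta>i" if "s \<le> 1" "ennreal \<delta> \<le> \<delta>i" for s \<delta>i
  proof -
    have "(1 + s) * \<eta> \<le> 2 * \<eta>" using that \<open>0 < \<eta>\<close> by (intro mult_right_mono) auto
    then have "ennreal ((1 + s) * \<eta>) \<le> ennreal \<delta>" by (intro ennreal_leI) (simp add: \<eta>_def)
    then show ?thesis using that by simp
  qed
  \<comment> \<open>The bound \<open>r\<close> secures compact supports, \<open>1\<close> the radius, and \<open>1 / (4 * L)\<close> the contraction.\<close>
  define T3 where "T3 = Min {T1, T2, r, 1, 1 / (4 * L)}"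
  have T3: "0 < T3" "T3 \<le> T1" "T3 \<le> T2" "T3 \<le> r" "T3 \<le> 1" "T3 \<le> 1 / (4 * L)"
    using T1 T2 r by (auto simp: T3_def)
  have LT: "L * T \<le> 1 / 4" if "T \<le> T3" for T
  proof -
    have "L * T \<le> L * (1 / (4 * L))" using that T3(6) \<open>L > 0\<close> by (intro mult_left_mono) auto
    then show ?thesis using \<open>L > 0\<close> by simp
  qed
  have rectangle: "(t\<^sub>0 + s, ?h u s) \<in> Lambda1 I t\<^sub>0 \<phi>\<^sub>0 T' \<delta>' ?v"
    if s: "s \<in> {0..T3}" and u: "admissible_velocity ?v \<eta> s u"
      and "T3 \<le> T'" "ennreal \<delta> \<le> \<delta>'" for s u T' \<delta>'
  proof (rule history_prolong_in_Lambda1[OF I \<phi>I _ u])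
    show "s \<in> {0..T'}" using s \<open>T3 \<le> T'\<close> by simp
    show "ennreal ((1 + s) * \<eta>) \<le> \<delta>'"
      using s T3(5) by (intro radius \<open>ennreal \<delta> \<le> \<delta>'\<close>) simp
  qed
  have dom: "(t\<^sub>0 + s, ?h u s) \<in> D" if "s \<in> {0..T3}" "admissible_velocity ?v \<eta> s u" for s u
    using rectangle[OF that T3(2) \<delta>(1)] T1(3) by blast
  have lips: "norm (F (t\<^sub>0 + s, ?h u s) - F (t\<^sub>0 + s, ?h w s)) \<le> L * (s * d)"
    if s: "s \<in> {0..T3}" and u: "admissible_velocity ?v \<eta> s u" and w: "admissible_velocity ?v \<eta> s w"
      and "0 \<le> d" and d: "\<And>r. r \<in> {0..s} \<Longrightarrow> norm (u r - w r) \<le> d" for s u w d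
  proof -
    have *: "(t\<^sub>0 + s, ?h q s) \<in> Lambda1 I t\<^sub>0 \<phi>\<^sub>0 T2 \<delta>2 ?v \<inter> D" if "admissible_velocity ?v \<eta> s q" for q
      using dom[OF s that] rectangle[OF s that T3(3) \<delta>(2)] by blast
    have "compact (supp_on I (\<lambda>\<theta>. ?h u s \<theta> - ?h w s \<theta>))"
      using s T3 by (intro r) (auto simp: history_def prolong_def)
    then have "ennreal (norm (F (t\<^sub>0 + s, ?h u s) - F (t\<^sub>0 + s, ?h w s)))
        \<le> ennreal L * sup_norm_on I (\<lambda>\<theta>. ?h u s \<theta> - ?h w s \<theta>)"
      by (intro Lip * u w)
    also have "\<dots> \<le> ennreal L * ennreal (s * d)"
      using u w s \<open>0 \<le> d\<close> d
      by (intro mult_left_mono sup_norm_history_prolong_diff_le I) (auto simp: admissible_velocity_def)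
    also have "\<dots> = ennreal (L * (s * d))" using \<open>L > 0\<close> s \<open>0 \<le> d\<close> by (simp add: ennreal_mult)
    finally show ?thesis using \<open>L > 0\<close> s \<open>0 \<le> d\<close> by (subst (asm) ennreal_le_iff) auto
  qed
  have cont: "continuous_on {0..T} (\<lambda>s. F (t\<^sub>0 + s, ?h u s))"
    if "continuous_on {0..} u" "\<And>s. s \<in> {0..T} \<Longrightarrow> (t\<^sub>0 + s, ?h u s) \<in> D" for u T
    by (rule continuous_on_F_history_prolong[OF I assms(5) \<phi>X \<phi>I F that])
  have "continuous_on {0..T3} (\<lambda>s. F (t\<^sub>0 + s, ?h (\<lambda>_. ?v) s))"
    using \<open>0 < \<eta>\<close> by (intro cont dom) (auto simp: admissible_velocity_def)
  from continuous_on_iff[THEN iffD1, OF this, THEN bspec, of 0, THEN spec, of "\<eta> / 2"]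
  obtain T4 where T4: "T4 > 0" and drift: "\<And>s. \<lbrakk>s \<in> {0..T3}; dist s 0 < T4\<rbrakk>
      \<Longrightarrow> dist (F (t\<^sub>0 + s, ?h (\<lambda>_. ?v) s)) (F (t\<^sub>0 + 0, ?h (\<lambda>_. ?v) 0)) < \<eta> / 2"
    using \<open>0 < \<eta>\<close> T3(1) by auto
  define T where "T = min T3 (T4 / 2)"
  have "0 < T" "T \<le> T3" "T < T4" using T3 T4 by (auto simp: T_def)
  interpret retarded_picard I D F t\<^sub>0 \<phi>\<^sub>0 T L \<eta>
  proof
    show "norm (F (t\<^sub>0 + s, ?h (\<lambda>_. ?v) s) - ?v) \<le> \<eta> / 2" if "s \<in> {0..T}" for s
      using drift[of s] that \<open>T \<le> T3\<close> \<open>T < T4\<close>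
      by (simp add: history_prolong_0 I \<phi>I dist_norm)
    show "(t\<^sub>0 + s, ?h u s) \<in> D" if "s \<in> {0..T}" "admissible_velocity ?v \<eta> s u" for s u
      using that(1) \<open>T \<le> T3\<close> by (intro dom that(2)) simp
    show "norm (F (t\<^sub>0 + s, ?h u s) - F (t\<^sub>0 + s, ?h w s)) \<le> L * (s * d)"
      if "s \<in> {0..T}" "admissible_velocity ?v \<eta> s u" "admissible_velocity ?v \<eta> s w"
        "0 \<le> d" "\<And>r. r \<in> {0..s} \<Longrightarrow> norm (u r - w r) \<le> d" for s u w d
      using that(1) \<open>T \<le> T3\<close> by (intro lips that(2-5)) simp_all
    show "0 \<le> L" using \<open>L > 0\<close> by simp
  qed (fact I \<phi>I \<open>0 < T\<close> \<open>0 < \<eta>\<close> LT[OF \<open>T \<le> T3\<close>] cont)+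
  show ?thesis using \<open>0 < T\<close> unique_C1_solution by blast
qed

end
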